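(* Let $a,b$ be reals such that $0<a<1$ and $b\geq 100$. Let $K>0$ be the largest integer such that $R=e^{2K\pi/b}\leq 2$. Then $$\int_R^\infty f(t,a)\sin(b\log t)\,dt=\sum_{k=K}^\infty \int_{\exp(2k\pi/b)}^{\exp((2k+1)\pi/b)}h(t,a,b)\sin(b\log t)\,dt.$$
   Context: For real $t>0$, $f(t,a):=\dfrac{t^{a-1}}{e^t+1}$ and $$h(t,a,b):=\frac{t^{a-1}}{e^t+1}-\frac{t^{a-1}e^{a\pi/b}}{e^{te^{\pi/b}}+1}.$$ *)

theory Defs
  imports "HOL-Analysis.Analysis"
begin

text \<open>The functions below are meant for \<open>t > 0\<close>, where \<open>powr\<close> is the usual real power.\<close>

definition f_fun :: "real \<Rightarrow> real \<Rightarrow> real" where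
  "f_fun t a = t powr (a - 1) / (exp t + 1)"

definition h_fun :: "real \<Rightarrow> real \<Rightarrow> real \<Rightarrow> real" where
  "h_fun t a b =
     t powr (a - 1) / (exp t + 1)
     - t powr (a - 1) * exp (a * pi / b) / (exp (t * exp (pi / b)) + 1)"

end

theory Submission
  imports Defs
begin

text \<open>
  The idea is a change of variables that pairs neighbouring half-periods of
  \<open>sin (b * ln t)\<close>. Put \<open>c = exp (pi / b)\<close> and \<open>g t = f_fun t a * sin (b * ln t)\<close>.
  Replacing \<open>t\<close> by \<open>c * t\<close> adds \<open>pi\<close> to the phase \<open>b * ln t\<close>, hence changes the sign of the
  sine, and this gives \<open>h_fun t a b * sin (b * ln t) = g t + c * g (c * t)\<close>
  (\<open>h_fun_times_sin\<close>). Over \<open>[u, c * u]\<close> the first summand integrates to the integral of \<open>g\<close>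
  over \<open>[u, c * u]\<close>, and the second, by substitution, to that of \<open>g\<close> over
  \<open>[c * u, c * c * u]\<close> (\<open>set_integral_fold_half_periods\<close>). With \<open>u = exp (2 * k * pi / b)\<close>
  the \<open>k\<close>-th summand of the series is therefore the integral of \<open>g\<close> over the full period from
  \<open>exp (2 * k * pi / b)\<close> to \<open>exp (2 * (k + 1) * pi / b)\<close>, and the series telescopes.

  The partial sums converge to the integral over the half-line because \<open>g\<close> is absolutely
  integrable there: for \<open>t \<ge> 1\<close> and \<open>a < 1\<close> the factor \<open>t powr (a - 1)\<close> is at most \<open>1\<close>, and
  so \<open>exp (- t)\<close> dominates \<open>g\<close>.
\<close>

lemma set_integrable_exp_minus_atLeast:
  "set_integrable lborel {r..} (\<lambda>t::real. exp (- t))"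
proof -
  have "(\<lambda>t::real. exp (- t)) absolutely_integrable_on {r..}"
    using integrable_on_exp_minus_to_infinity[of 1 r]
    by (intro nonnegative_absolutely_integrable_1) auto
  thus ?thesis
    unfolding set_integrable_def by (subst (asm) integrable_completion) auto
qed

lemma continuous_on_f_fun_times_sin:
  "continuous_on {0<..} (\<lambda>t. f_fun t a * sin (b * ln t))"
  unfolding f_fun_def by (intro continuous_intros) (auto simp: add_pos_pos less_imp_neq[symmetric])

lemma f_fun_le_exp_minus:
  assumes "a \<le> 1" "1 \<le> t"
  shows "f_fun t a \<le> exp (- t)"
proof -
  have "t powr (a - 1) \<le> 1"
    using powr_mono[of "a - 1" 0 t] assms by simp
  hence "f_fun t a \<le> 1 / exp t"
    unfolding f_fun_def by (intro frac_le) auto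
  thus ?thesis
    by (simp add: exp_minus field_simps)
qed

lemma set_integrable_f_fun_times_sin:
  assumes "a \<le> 1" "1 \<le> r"
  shows "set_integrable lborel {r..} (\<lambda>t. f_fun t a * sin (b * ln t))"
proof (rule set_integrable_bound[OF set_integrable_exp_minus_atLeast])
  have "continuous_on {r..} (\<lambda>t. f_fun t a * sin (b * ln t))"
    using assms by (intro continuous_on_subset[OF continuous_on_f_fun_times_sin]) auto
  thus "set_borel_measurable lborel {r..} (\<lambda>t. f_fun t a * sin (b * ln t))"
    unfolding set_borel_measurable_def measurable_lborel2
    by (rule borel_measurable_continuous_on_indicator[rotated]) auto
  have "\<bar>f_fun t a * sin (b * ln t)\<bar> \<le> exp (- t)" if "r \<le> t" for t
  proof -
    have "0 \<le> f_fun t a"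
      by (simp add: f_fun_def add_nonneg_nonneg)
    hence "\<bar>f_fun t a * sin (b * ln t)\<bar> \<le> f_fun t a"
      by (simp add: abs_mult mult_left_le)
    also have "\<dots> \<le> exp (- t)"
      using assms that by (intro f_fun_le_exp_minus) auto
    finally show ?thesis .
  qed
  thus "AE t in lborel. t \<in> {r..} \<longrightarrow>
      norm (f_fun t a * sin (b * ln t)) \<le> norm (exp (- t))"
    by auto
qed

text \<open>
  The sign of the second term of \<open>h_fun\<close> is absorbed by \<open>sin (x + pi) = - sin x\<close>, and its
  factor \<open>exp (a * pi / b)\<close> splits into \<open>c powr (a - 1)\<close>, coming from \<open>f_fun (c * t) a\<close>, and the
  Jacobian \<open>c\<close> of \<open>t \<mapsto> c * t\<close>, where \<open>c = exp (pi / b)\<close>.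
\<close>
lemma h_fun_times_sin:
  assumes "b \<noteq> 0" "0 < t"
  shows "h_fun t a b * sin (b * ln t) =
    f_fun t a * sin (b * ln t) +
    exp (pi / b) * (f_fun (exp (pi / b) * t) a * sin (b * ln (exp (pi / b) * t)))"
proof -
  define c where "c = exp (pi / b)"
  have "b * ln (c * t) = b * ln t + pi"
    using assms by (simp add: c_def ln_mult algebra_simps)
  hence sin: "sin (b * ln (c * t)) = - sin (b * ln t)"
    by simp
  have "exp (a * pi / b) = c * c powr (a - 1)"
    by (simp add: c_def powr_def exp_add[symmetric] algebra_simps diff_divide_distrib)
  moreover have "c > 0"
    by (simp add: c_def)
  ultimately have "h_fun t a b = f_fun t a - c * f_fun (c * t) a"
    using assms unfolding h_fun_def f_fun_def c_def[symmetric]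
    by (simp add: powr_mult mult_ac)
  thus ?thesis
    unfolding c_def[symmetric] sin by (simp only:) (simp add: ring_distribs)
qed

text \<open>
  The map \<open>t \<mapsto> c * t\<close> carries \<open>[u, c * u]\<close> onto the adjacent interval
  \<open>[c * u, c * c * u]\<close>, and the factor \<open>c\<close> in front of \<open>g (c * t)\<close> is its Jacobian, so the
  integral over the adjacent interval is folded back onto \<open>[u, c * u]\<close>.
\<close>
lemma set_integral_fold_half_periods:
  fixes g :: "real \<Rightarrow> real"
  assumes "1 \<le> c" "0 \<le> u" and cont: "continuous_on {u..c * (c * u)} g"
  shows "set_integrable lborel {u..c * u} (\<lambda>t. g t + c * g (c * t))"
    and "(LBINT t:{u..c * u}. g t + c * g (c * t)) = (LBINT t:{u..c * (c * u)}. g t)"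
proof -
  have ord: "u \<le> c * u" "c * u \<le> c * (c * u)"
    using assms mult_right_mono[of 1 c u] mult_right_mono[of 1 c "c * u"] by auto
  have contc: "continuous_on {u..c * u} (\<lambda>t. g (c * t))"
  proof (rule continuous_on_compose2[OF cont])
    show "(*) c ` {u..c * u} \<subseteq> {u..c * (c * u)}"
    proof safe
      fix t assume "t \<in> {u..c * u}"
      hence "c * u \<le> c * t" "c * t \<le> c * (c * u)"
        using assms by (auto intro!: mult_left_mono)
      thus "c * t \<in> {u..c * (c * u)}"
        using ord by auto
    qed
  qed (auto intro!: continuous_intros)
  have contu: "continuous_on {u..c * u} g"
    using ord by (intro continuous_on_subset[OF cont]) auto
  have cont_sum: "continuous_on {u..c * u} (\<lambda>t. g t + c * g (c * t))"
    by (intro continuous_intros contc contu)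
  show int: "set_integrable lborel {u..c * u} (\<lambda>t. g t + c * g (c * t))"
    unfolding set_integrable_def by (intro borel_integrable_compact cont_sum) auto
  have intg: "set_integrable lborel {u..c * (c * u)} g"
    unfolding set_integrable_def by (intro borel_integrable_compact cont) auto
  have upper: "((\<lambda>t. c *\<^sub>R g (c * t)) has_integral integral {c * u..c * (c * u)} g) {u..c * u}"
  proof (rule has_integral_substitution)
    show "(*) c ` {u..c * u} \<subseteq> {c * u..c * (c * u)}"
      using assms by (auto intro!: mult_left_mono)
    show "continuous_on {c * u..c * (c * u)} g"
      using ord by (intro continuous_on_subset[OF cont]) auto
  qed (use ord in \<open>auto intro!: derivative_eq_intros\<close>)
  have lower: "(g has_integral integral {u..c * u} g) {u..c * u}"
    using integrable_continuous_interval[OF contu] by (rule integrable_integral)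
  have "((\<lambda>t. g t + c * g (c * t)) has_integral
      integral {u..c * u} g + integral {c * u..c * (c * u)} g) {u..c * u}"
    using has_integral_add[OF lower upper] by simp
  hence "integral {u..c * u} (\<lambda>t. g t + c * g (c * t)) =
      integral {u..c * u} g + integral {c * u..c * (c * u)} g"
    by (rule integral_unique)
  also have "\<dots> = integral {u..c * (c * u)} g"
    using ord integrable_continuous_interval[OF cont]
    by (intro Henstock_Kurzweil_Integration.integral_combine)
  finally show "(LBINT t:{u..c * u}. g t + c * g (c * t)) = (LBINT t:{u..c * (c * u)}. g t)"
    using set_borel_integral_eq_integral(2)[OF int] set_borel_integral_eq_integral(2)[OF intg]
    by simp
qed

text \<open>
  The partial sums telescope to integrals over \<open>[e 0, e N]\<close>; absolute integrability on the
  half-line lets \<open>N\<close> tend to infinity by dominated convergence.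
\<close>
lemma sums_set_integral_intervals:
  fixes g :: "real \<Rightarrow> real" and e :: "nat \<Rightarrow> real"
  assumes "mono e" and lim: "filterlim e at_top sequentially"
    and int: "set_integrable lborel {e 0..} g"
  shows "(\<lambda>n. LBINT t:{e n..e (Suc n)}. g t) sums (LBINT t:{e 0..}. g t)"
proof -
  have sub: "set_integrable lborel {e m..e n} g" for m n
    using monoD[OF \<open>mono e\<close>, of 0 m]
    by (intro set_integrable_subset[OF int]) auto
  have "(\<Sum>n<N. LBINT t:{e n..e (Suc n)}. g t) = (LBINT t:{e 0..e N}. g t)" for N
  proof (induction N)
    case 0
    show ?case
      using set_borel_integral_eq_integral(2)[OF sub[of 0 0]] by simp
  next
    case (Suc N)
    have "integral {e 0..e N} g + integral {e N..e (Suc N)} g = integral {e 0..e (Suc N)} g"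
      by (intro Henstock_Kurzweil_Integration.integral_combine monoD[OF \<open>mono e\<close>]
          set_borel_integral_eq_integral(1)[OF sub]) auto
    thus ?case
      using Suc.IH by (simp add: set_borel_integral_eq_integral(2)[OF sub])
  qed
  moreover have "(\<lambda>N. LBINT t:{e 0..e N}. g t) \<longlonglongrightarrow> (LBINT t:{e 0..}. g t)"
    using filterlim_compose[OF tendsto_set_lebesgue_integral_at_top[OF _ int] lim] by simp
  ultimately show ?thesis
    unfolding sums_def by simp
qed

theorem theorem6:
  fixes a b R :: real and K :: int
  assumes "0 < a" and "a < 1" and "b \<ge> 100"
    and "K > 0"
    and "R = exp (2 * of_int K * pi / b)"
    and "R \<le> 2"
    and "\<And>j :: int. exp (2 * of_int j * pi / b) \<le> 2 \<Longrightarrow> j \<le> K"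
  shows "set_integrable lborel {R..} (\<lambda>t. f_fun t a * sin (b * ln t))
    \<and> (\<forall>k\<ge>K. set_integrable lborel
           {exp (2 * of_int k * pi / b)..exp ((2 * of_int k + 1) * pi / b)}
           (\<lambda>t. h_fun t a b * sin (b * ln t)))
    \<and> (\<lambda>n. let k = K + int n in
          LBINT t:{exp (2 * of_int k * pi / b)..exp ((2 * of_int k + 1) * pi / b)}.
            h_fun t a b * sin (b * ln t))
        sums (LBINT t:{R..}. f_fun t a * sin (b * ln t))"
proof -
  define g where "g t = f_fun t a * sin (b * ln t)" for t
  define c where "c = exp (pi / b)"
  define e where "e k = exp (2 * of_int k * pi / b)" for k :: int
  have "b > 0" "c \<ge> 1"
    using assms by (auto simp: c_def)
  have e_pos: "e k > 0" for k
    by (simp add: e_def)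
  have e_odd: "exp ((2 * of_int k + 1) * pi / b) = c * e k" for k :: int
    by (simp add: e_def c_def exp_add[symmetric] add_divide_distrib algebra_simps)
  have e_next: "e (k + 1) = c * (c * e k)" for k
    by (simp add: e_def c_def exp_add[symmetric] add_divide_distrib algebra_simps)
  have R: "R = e K" "R \<ge> 1"
    using assms by (auto simp: e_def)
  have int: "set_integrable lborel {R..} g"
    unfolding g_def using set_integrable_f_fun_times_sin[of a R b] assms R by auto
  have cont: "continuous_on {e k..c * (c * e k)} g" for k
    unfolding g_def using e_pos[of k]
    by (intro continuous_on_subset[OF continuous_on_f_fun_times_sin]) auto
  have h: "h_fun t a b * sin (b * ln t) = g t + c * g (c * t)" if "t \<in> {e k..c * e k}" for k t
    using that e_pos[of k] \<open>b > 0\<close> h_fun_times_sin[of b t a] by (auto simp: g_def c_def)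
  have h_int: "set_integrable lborel {e k..c * e k} (\<lambda>t. h_fun t a b * sin (b * ln t))" for k
    using set_integral_fold_half_periods(1)[OF \<open>c \<ge> 1\<close> less_imp_le[OF e_pos] cont]
    by (subst set_integrable_cong[OF refl refl h])
  have "(LBINT t:{e k..c * e k}. h_fun t a b * sin (b * ln t)) =
      (LBINT t:{e k..c * e k}. g t + c * g (c * t))" for k
    using h by (intro set_lebesgue_integral_cong) auto
  hence h_eq: "(LBINT t:{e k..c * e k}. h_fun t a b * sin (b * ln t)) =
      (LBINT t:{e k..e (k + 1)}. g t)" for k
    using set_integral_fold_half_periods(2)[OF \<open>c \<ge> 1\<close> less_imp_le[OF e_pos] cont]
    by (simp add: e_next)
  have "mono (\<lambda>n. e (K + int n))"
    using \<open>b > 0\<close> by (auto simp: mono_def e_def divide_right_mono)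
  moreover have "filterlim (\<lambda>n. e (K + int n)) at_top sequentially"
    unfolding e_def
  proof (rule filterlim_compose[OF exp_at_top])
    have "filterlim (\<lambda>n. 2 * of_int K * pi / b + 2 * pi / b * real n) at_top sequentially"
      using \<open>b > 0\<close>
      by (intro filterlim_tendsto_add_at_top[OF tendsto_const]
            filterlim_tendsto_pos_mult_at_top[OF tendsto_const _ filterlim_real_sequentially]) auto
    thus "filterlim (\<lambda>n. 2 * of_int (K + int n) * pi / b) at_top sequentially"
      by (simp add: algebra_simps add_divide_distrib)
  qed
  ultimately have "(\<lambda>n. LBINT t:{e (K + int n)..e (K + int (Suc n))}. g t) sums
      (LBINT t:{e (K + int 0)..}. g t)"
    using int R by (intro sums_set_integral_intervals) auto
  hence "(\<lambda>n. LBINT t:{e (K + int n)..c * e (K + int n)}. h_fun t a b * sin (b * ln t)) sums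
      (LBINT t:{R..}. g t)"
    unfolding h_eq by (simp add: R add_ac)
  with int h_int show ?thesis
    unfolding e_odd Let_def g_def e_def[symmetric] by simp
qed

end
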